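(* Let $n \ge 1$. Then $\psi_{2^{n-1},n} = -\phi_{2^n,n}$, and this $2$-cocycle encodes the periods in $A_n$ in the following sense: for every $p$ with $1 \le p < 2^n$, the period $\pi_n(p)$ is the smallest $y \in A_n$ satisfying $\psi_{2^{n-1},n}(p,y) = 1$.
   Context: For $n \ge 0$, the $n$th Laver table is the set $A_n = \{1,\dots,2^n\}$ equipped with the unique binary operation $\triangleright_n$ such that, for all $x,y$, $x \triangleright_n 1 = (x+1) \bmod 2^n$ and $x \triangleright_n (y \triangleright_n 1) = (x \triangleright_n y) \triangleright_n (x \triangleright_n 1)$, where $a \bmod m$ denotes the unique integer in $\{1,\dots,m\}$ congruent to $a$ modulo $m$. (By a known theorem of Laver this operation exists, is unique, and satisfies the left-selfdistributivity law $x \triangleright (y \triangleright z) = (x \triangleright y) \triangleright (x \triangleright z)$.) Period: it is known (Laver) that for every $p \in A_n$ there is a unique power of two $2^r$ such that $p \triangleright_n 1 < p \triangleright_n 2 < \cdots < p \triangleright_n 2^r = 2^n$, and the subsequent values $p \triangleright_n q$ repeat periodically with period $2^r$; this number $2^r$ is denoted $\pi_n(p)$. For $q,r \in A_n$, write $r \Vdash_n q$ if there exists $s \in A_n$ with $s \triangleright_n r = q$. For $q \in A_n$ define maps $A_n^2 \to \mathbb{Z}$ by $\phi_{q,n}(x,y) = \delta_{y,q} - \delta_{x \triangleright_n y,\,q}$ ($\delta$ is the Kronecker symbol) and $\psi_{q,n} = \sum_{r \in A_n,\ r \Vdash_n q} \phi_{r,n}$. (These are rack $2$-cocycles, i.e.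 maps $\phi$ satisfying $\phi(x \triangleright y, x \triangleright z) + \phi(x,z) = \phi(x, y\triangleright z) + \phi(y,z)$.) *)

theory Defs
  imports Main
begin

definition laver_carrier :: "nat \<Rightarrow> nat set" where
  "laver_carrier n = {1..2 ^ n}"

text \<open>The representative of \<open>a\<close> modulo \<open>m\<close> in \<open>{1..m}\<close> (for \<open>m > 0\<close>), so \<open>m\<close> in place of \<open>0\<close>.\<close>

definition mod1 :: "nat \<Rightarrow> nat \<Rightarrow> nat" where
  "mod1 a m = (if a mod m = 0 then m else a mod m)"

text \<open>These conditions determine the operation uniquely on the carrier; its values elsewhere are
  unconstrained.\<close>

definition laver_table :: "nat \<Rightarrow> (nat \<Rightarrow> nat \<Rightarrow> nat) \<Rightarrow> bool" where
  "laver_table n f \<longleftrightarrow>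
     (\<forall>x\<in>laver_carrier n. \<forall>y\<in>laver_carrier n. f x y \<in> laver_carrier n) \<and>
     (\<forall>x\<in>laver_carrier n. f x 1 = mod1 (x + 1) (2 ^ n)) \<and>
     (\<forall>x\<in>laver_carrier n. \<forall>y\<in>laver_carrier n. f x (f y 1) = f (f x y) (f x 1))"

definition is_laver_period :: "nat \<Rightarrow> (nat \<Rightarrow> nat \<Rightarrow> nat) \<Rightarrow> nat \<Rightarrow> nat \<Rightarrow> bool" where
  "is_laver_period n f p m \<longleftrightarrow>
     m \<in> laver_carrier n \<and> (\<exists>r. m = 2 ^ r) \<and>
     strict_mono_on {1..m} (f p) \<and> f p m = 2 ^ n \<and>
     (\<forall>q\<in>laver_carrier n. q + m \<in> laver_carrier n \<longrightarrow> f p (q + m) = f p q)"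

definition laver_period :: "nat \<Rightarrow> (nat \<Rightarrow> nat \<Rightarrow> nat) \<Rightarrow> nat \<Rightarrow> nat" where
  "laver_period n f p = (THE m. is_laver_period n f p m)"

text \<open>\<open>laver_forces n f r q\<close> stands for \<open>r \<tturnstile>\<^sub>n q\<close>.\<close>

definition laver_forces :: "nat \<Rightarrow> (nat \<Rightarrow> nat \<Rightarrow> nat) \<Rightarrow> nat \<Rightarrow> nat \<Rightarrow> bool" where
  "laver_forces n f r q \<longleftrightarrow> (\<exists>s\<in>laver_carrier n. f s r = q)"

definition laver_phi :: "(nat \<Rightarrow> nat \<Rightarrow> nat) \<Rightarrow> nat \<Rightarrow> nat \<Rightarrow> nat \<Rightarrow> int" where
  "laver_phi f q x y = of_bool (y = q) - of_bool (f x y = q)"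

definition laver_psi :: "nat \<Rightarrow> (nat \<Rightarrow> nat \<Rightarrow> nat) \<Rightarrow> nat \<Rightarrow> nat \<Rightarrow> nat \<Rightarrow> int" where
  "laver_psi n f q x y = (\<Sum>r | r \<in> laver_carrier n \<and> laver_forces n f r q. laver_phi f r x y)"

end

theory Submission
  imports Defs "HOL-Computational_Algebra.Primes"
begin

text \<open>
  Write \<open>N = 2\<^sup>n\<close> and \<open>H = 2\<^sup>n\<^sup>-\<^sup>1\<close>. By descending induction on \<open>x < N\<close>, the row of \<open>x\<close> increases
  strictly from \<open>x + 1\<close> until it reaches \<open>N\<close>, and then starts again; the last column is constantly
  \<open>N\<close>, so the period divides \<open>N\<close>. The cocycle identity amounts to the fact that exactly the \<open>r < N\<close>
  force \<open>H\<close>. For \<open>r = 2\<^sup>j (2c + 1)\<close> with \<open>j < n - 1\<close> a witness is \<open>p = H - 2\<^sup>j\<close>: comparing row \<open>u\<close>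
  with row \<open>H + u\<close>, whose period is at most \<open>H - u\<close>, one finds \<open>p \<triangleright> q = p + q\<close> for
  \<open>q \<le> 2\<^sup>j\<close>, hence \<open>p \<triangleright> 2\<^sup>j = H\<close>, and that row \<open>p\<close> has period \<open>2\<^sup>j\<^sup>+\<^sup>1\<close>.
\<close>

text \<open>This is \<open>2 ^ j * (2 * c + 1)\<close>, written so that periodicity with
  \<open>2 ^ Suc j\<close> reduces column \<open>r\<close> to column \<open>2 ^ j\<close>.\<close>

lemma two_power_odd_decomp:
  fixes r :: nat
  assumes "1 \<le> r"
  shows "\<exists>j c. r = 2 ^ j + c * 2 ^ Suc j"
  using assms
proof (induction r rule: less_induct)
  case (less r)
  show ?case
  proof (cases "even r")
    case True
    then obtain s where s: "r = 2 * s" ..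
    with less.prems have "s < r" "1 \<le> s" by auto
    then obtain j c where "s = 2 ^ j + c * 2 ^ Suc j" using less.IH by blast
    with s have "r = 2 ^ Suc j + c * 2 ^ Suc (Suc j)" by simp
    then show ?thesis by blast
  next
    case False
    then obtain c where "r = 2 * c + 1" ..
    then have "r = 2 ^ 0 + c * 2 ^ Suc 0" by simp
    then show ?thesis by blast
  qed
qed

text \<open>Two candidates \<open>a < b\<close> would both carry the value \<open>2 ^ n\<close>,
  against strict increase up to \<open>b\<close>.\<close>

lemma is_laver_period_unique:
  assumes "is_laver_period n f p m" and "is_laver_period n f p m'"
  shows "m = m'"
proof -
  have "\<not> a < b" if "is_laver_period n f p a" "is_laver_period n f p b" for a b
  proof
    assume "a < b"
    moreover have "strict_mono_on {1..b} (f p)" "1 \<le> a" "f p a = f p b"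
      using that by (auto simp: is_laver_period_def laver_carrier_def)
    ultimately have "f p a < f p b" by (intro strict_mono_onD[of "{1..b}" "f p"]) auto
    with \<open>f p a = f p b\<close> show False by simp
  qed
  with assms show ?thesis by (meson linorder_neqE_nat)
qed

lemma laver_period_eqI: "is_laver_period n f p m \<Longrightarrow> laver_period n f p = m"
  unfolding laver_period_def by (blast intro: is_laver_period_unique)

section \<open>Rows and columns of a Laver table\<close>

locale laver =
  fixes n :: nat and f :: "nat \<Rightarrow> nat \<Rightarrow> nat"
  assumes table: "laver_table n f"
begin

lemma closed:
  assumes "1 \<le> x" "x \<le> 2 ^ n" "1 \<le> y" "y \<le> 2 ^ n"
  shows "1 \<le> f x y" "f x y \<le> 2 ^ n"
  using table assms by (auto simp: laver_table_def laver_carrier_def)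

lemma first_column: "1 \<le> x \<Longrightarrow> x < 2 ^ n \<Longrightarrow> f x 1 = x + 1"
  using table by (cases "x + 1 = 2 ^ n") (auto simp: laver_table_def laver_carrier_def mod1_def)

lemma top_first_column: "f (2 ^ n) 1 = 1"
proof -
  have "f (2 ^ n) 1 = mod1 (2 ^ n + 1) (2 ^ n)"
    using table by (auto simp: laver_table_def laver_carrier_def)
  also have "\<dots> = 1"
  \<comment> \<open>For \<open>n = 0\<close> the residue is \<open>0\<close>, and
    \<open>mod1\<close> returns the modulus, which is then \<open>1\<close>.\<close>
  proof (cases "n = 0")
    case False
    then have "(2 ^ n + 1) mod 2 ^ n = (1::nat)" by (subst mod_add_self1) simp
    then show ?thesis by (simp add: mod1_def)
  qed (simp add: mod1_def)
  finally show ?thesis .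
qed

lemma recursion:
  assumes "1 \<le> x" "x \<le> 2 ^ n" "1 \<le> y" "y \<le> 2 ^ n"
  shows "f x (f y 1) = f (f x y) (f x 1)"
proof -
  have "x \<in> laver_carrier n" "y \<in> laver_carrier n" using assms by (auto simp: laver_carrier_def)
  with table show ?thesis unfolding laver_table_def by blast
qed

lemma row_rec:
  assumes "1 \<le> x" "x \<le> 2 ^ n" "1 \<le> y" "y < 2 ^ n"
  shows "f x (y + 1) = f (f x y) (f x 1)"
  using recursion[of x y] first_column[of y] assms by simp

lemma row_step:
  assumes "1 \<le> x" "x < 2 ^ n" "1 \<le> y" "y < 2 ^ n"
  shows "f x (y + 1) = f (f x y) (x + 1)"
  using row_rec[of x y] first_column[of x] assms by simp

lemma top_row:
  assumes "1 \<le> y" "y \<le> 2 ^ n"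
  shows "f (2 ^ n) y = y"
  using assms
proof (induction y rule: dec_induct)
  case base
  show ?case by (rule top_first_column)
next
  case (step y)
  then have "f (2 ^ n) (y + 1) = f y 1"
    using row_rec[of "2 ^ n" y] top_first_column by simp
  with step first_column[of y] show ?case by simp
qed

text \<open>The entry after \<open>f x y\<close> is read off in row \<open>f x y\<close> at column
  \<open>x + 1\<close>. That row has a larger index, so the outer descending induction applies to
  it, unless it is the top row, which acts as the identity and returns \<open>x + 1\<close>.\<close>

lemma row_greater:
  assumes "1 \<le> x" "x < 2 ^ n" "1 \<le> y" "y \<le> 2 ^ n"
  shows "x < f x y"
  using assms
proof (induction "2 ^ n - x" arbitrary: x y rule: less_induct)
  case less
  note IH = less.hyps and x = less.prems(1,2)
  from less.prems(3,4) show ?case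
  proof (induction y rule: dec_induct)
    case base
    show ?case using first_column[OF x] by simp
  next
    case (step y)
    then have y: "1 \<le> y" "y < 2 ^ n" and gt: "x < f x y" by auto
    have eq: "f x (Suc y) = f (f x y) (x + 1)" using row_step[OF x y] by simp
    have le: "f x y \<le> 2 ^ n" using closed[of x y] x y by simp
    show ?case
    proof (cases "f x y = 2 ^ n")
      case True
      with eq top_row[of "x + 1"] x show ?thesis by simp
    next
      case False
      with le have "f x y < f (f x y) (x + 1)" using IH[of "f x y" "x + 1"] gt x by simp
      with eq gt show ?thesis by simp
    qed
  qed
qed

lemma row_increases:
  assumes "1 \<le> x" "x < 2 ^ n" "1 \<le> y" "y < 2 ^ n" "f x y \<noteq> 2 ^ n"
  shows "f x y < f x (y + 1)"
proof -
  have "1 \<le> f x y" "f x y < 2 ^ n" using closed[of x y] assms by auto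
  then have "f x y < f (f x y) (x + 1)" by (rule row_greater) (use assms in auto)
  then show ?thesis using row_step[OF assms(1-4)] by metis
qed

text \<open>After the value \<open>2 ^ n\<close> the next entry comes from the identity row and is
  \<open>x + 1\<close>, the first entry of row \<open>x\<close>. Each entry determines its
  successor, so the row repeats from there.\<close>

lemma row_restarts:
  assumes "1 \<le> x" "x < 2 ^ n" "1 \<le> d" "f x d = 2 ^ n" "1 \<le> y" "d + y \<le> 2 ^ n"
  shows "f x (d + y) = f x y"
  using assms(5,6)
proof (induction y rule: dec_induct)
  case base
  then show ?case using row_step[of x d] top_row[of "x + 1"] first_column[of x] assms by simp
next
  case (step y)
  then have IH: "f x (d + y) = f x y" by simp
  have "f x (d + y + 1) = f (f x (d + y)) (x + 1)"
    using step assms(1-3) by (intro row_step) auto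
  also have "\<dots> = f x (y + 1)"
    unfolding IH using step assms(1-3) by (intro row_step[symmetric]) auto
  finally show ?case by simp
qed

lemma row_periodic:
  assumes "1 \<le> x" "x < 2 ^ n" "1 \<le> d" "f x d = 2 ^ n" "1 \<le> y" "y + c * d \<le> 2 ^ n"
  shows "f x (y + c * d) = f x y"
  using assms(6)
proof (induction c)
  case (Suc c)
  then show ?case using row_restarts[of x d "y + c * d"] assms(1-5) by (simp add: ac_simps)
qed simp

text \<open>The recursion at \<open>y = 2 ^ n\<close>, where \<open>f y 1 = 1\<close> wraps around,
  makes \<open>x + 1\<close> an entry of row \<open>f x (2 ^ n)\<close>. Below the top row this
  entry would exceed \<open>f x (2 ^ n)\<close>, which itself exceeds \<open>x\<close>.\<close>

lemma last_column:
  assumes "1 \<le> x" "x \<le> 2 ^ n"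
  shows "f x (2 ^ n) = 2 ^ n"
proof (cases "x = 2 ^ n")
  case True
  then show ?thesis using top_row[of "2 ^ n"] by simp
next
  case False
  with assms have x: "1 \<le> x" "x < 2 ^ n" by auto
  have "f x (f (2 ^ n) 1) = f (f x (2 ^ n)) (f x 1)"
    using recursion[of x "2 ^ n"] x by simp
  then have eq: "x + 1 = f (f x (2 ^ n)) (x + 1)"
    using top_first_column first_column[OF x] by simp
  have "x < f x (2 ^ n)" "f x (2 ^ n) \<le> 2 ^ n"
    using row_greater[of x "2 ^ n"] closed[of x "2 ^ n"] x by auto
  moreover have "f x (2 ^ n) < x + 1" if "f x (2 ^ n) < 2 ^ n"
    using row_greater[of "f x (2 ^ n)" "x + 1"] that calculation x by (subst eq) simp
  ultimately show ?thesis by linarith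
qed

lemma row_ge_add:
  assumes "1 \<le> x" "x < 2 ^ n" "1 \<le> y" "y \<le> 2 ^ n"
    and "\<And>z. 1 \<le> z \<Longrightarrow> z < y \<Longrightarrow> f x z \<noteq> 2 ^ n"
  shows "x + y \<le> f x y"
  using assms(3-5)
proof (induction y rule: dec_induct)
  case base
  show ?case using first_column assms(1,2) by simp
next
  case (step y)
  then have "x + y \<le> f x y" by simp
  moreover have "f x y < f x (y + 1)" using step row_increases[of x y] assms(1,2) by simp
  ultimately show ?case by simp
qed

section \<open>Periods of rows\<close>

lemma ex_period:
  assumes x: "1 \<le> x" "x < 2 ^ n"
  shows "\<exists>m. is_laver_period n f x m"
proof -
  define m where "m = (LEAST y. 1 \<le> y \<and> f x y = 2 ^ n)"
  have "1 \<le> m \<and> f x m = 2 ^ n"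
    unfolding m_def by (rule LeastI[of _ "2 ^ n"]) (use x last_column in auto)
  then have m: "1 \<le> m" "f x m = 2 ^ n" by auto
  have least: "m \<le> y" if "1 \<le> y" "f x y = 2 ^ n" for y
    unfolding m_def by (rule Least_le) (use that in auto)
  have "m \<le> 2 ^ n" using least[of "2 ^ n"] last_column[of x] x by simp
  \<comment> \<open>Otherwise periodicity moves the value \<open>2 ^ n\<close> from the last column
    to column \<open>2 ^ n mod m\<close>, before its first occurrence at \<open>m\<close>.\<close>
  have "m dvd 2 ^ n"
  proof (rule ccontr)
    assume "\<not> m dvd 2 ^ n"
    then have "1 \<le> 2 ^ n mod m" by (simp add: dvd_eq_mod_eq_0 Suc_leI)
    moreover have "f x (2 ^ n mod m) = 2 ^ n"
      using row_periodic[of x m "2 ^ n mod m" "2 ^ n div m"] calculation m x last_column[of x]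
      by simp
    ultimately have "m \<le> 2 ^ n mod m" using least by blast
    moreover have "2 ^ n mod m < m" by (rule mod_less_divisor) (use m(1) in simp)
    ultimately show False by simp
  qed
  then have pow: "\<exists>r. m = 2 ^ r"
    using divides_primepow_nat[of 2 m n] two_is_prime_nat by blast
  have mono: "f x a < f x b" if "1 \<le> a" "Suc a \<le> b" "b \<le> m" for a b
    using that(2,3)
  proof (induction b rule: dec_induct)
    case base
    then show ?case
      using row_increases[of x a] least[of a] that(1) x \<open>m \<le> 2 ^ n\<close> by fastforce
  next
    case (step b)
    then have "f x b < f x (b + 1)"
      using row_increases[of x b] least[of b] x \<open>m \<le> 2 ^ n\<close> by fastforce
    with step show ?case by simp
  qed
  have "is_laver_period n f x m"
    unfolding is_laver_period_def laver_carrier_def strict_mono_on_def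
    using m \<open>m \<le> 2 ^ n\<close> pow mono row_restarts[OF x m] by (auto simp: ac_simps)
  then show ?thesis ..
qed

lemma period:
  assumes "1 \<le> x" "x < 2 ^ n"
  shows "is_laver_period n f x (laver_period n f x)"
  using ex_period[OF assms] laver_period_eqI by blast

lemma period_increasing:
  assumes "1 \<le> x" "x < 2 ^ n" "1 \<le> a" "a < b" "b \<le> laver_period n f x"
  shows "f x a < f x b"
proof -
  have "strict_mono_on {1..laver_period n f x} (f x)"
    using period[OF assms(1,2)] by (simp add: is_laver_period_def)
  then show ?thesis by (rule strict_mono_onD) (use assms in auto)
qed

lemma period_top: "1 \<le> x \<Longrightarrow> x < 2 ^ n \<Longrightarrow> f x (laver_period n f x) = 2 ^ n"
  using period[of x] by (simp add: is_laver_period_def)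

lemma period_least:
  assumes x: "1 \<le> x" "x < 2 ^ n" and y: "1 \<le> y" "f x y = 2 ^ n"
  shows "laver_period n f x \<le> y"
proof (rule ccontr)
  assume "\<not> laver_period n f x \<le> y"
  with x y(1) have "f x y < f x (laver_period n f x)" by (intro period_increasing) auto
  with y(2) period_top[OF x] show False by simp
qed

text \<open>Within one period the entries start at \<open>x + 1\<close>, grow by at least one per
  column and end at \<open>2 ^ n\<close>.\<close>

lemma add_period_le:
  assumes x: "1 \<le> x" "x < 2 ^ n"
  shows "x + laver_period n f x \<le> 2 ^ n"
proof -
  have *: "1 \<le> laver_period n f x" "laver_period n f x \<le> 2 ^ n"
    "f x (laver_period n f x) = 2 ^ n"
    using period[OF x] by (auto simp: is_laver_period_def laver_carrier_def)
  have "x + laver_period n f x \<le> f x (laver_period n f x)"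
    by (rule row_ge_add) (use x * period_least[OF x] in fastforce)+
  with * show ?thesis by simp
qed

text \<open>The period is a power of two below \<open>2 ^ Suc k\<close>, hence divides
  \<open>2 ^ k\<close>.\<close>

lemma top_if_period_less:
  assumes x: "1 \<le> x" "x < 2 ^ n" and "laver_period n f x < 2 ^ Suc k" "k \<le> n"
  shows "f x (2 ^ k) = 2 ^ n"
proof -
  obtain i where i: "laver_period n f x = 2 ^ i" and top: "f x (2 ^ i) = 2 ^ n"
    using period[OF x] by (auto simp: is_laver_period_def)
  with assms(3) have "i < Suc k" by (metis power_strict_increasing_iff one_less_numeral_iff semiring_norm(76))
  then have "(2::nat) ^ i dvd 2 ^ k" by (simp add: le_imp_power_dvd)
  then obtain c where c: "(2::nat) ^ k = 2 ^ i * c" ..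
  then obtain c' where "c = Suc c'" by (cases c) auto
  with c have eq: "(2::nat) ^ k = 2 ^ i + c' * 2 ^ i" by simp
  moreover have "(2::nat) ^ k \<le> 2 ^ n" using assms(4) by simp
  ultimately show ?thesis using row_periodic[of x "2 ^ i" "2 ^ i" c'] x top by simp
qed

lemma top_near_top:
  assumes "1 \<le> x" "x < 2 ^ n" "2 ^ n < x + 2 ^ Suc k" "k \<le> n"
  shows "f x (2 ^ k) = 2 ^ n"
  by (rule top_if_period_less) (use assms add_period_le[of x] in auto)

end

section \<open>Comparison of the lower and upper half of the table\<close>

locale laver_half = laver +
  fixes H k :: nat
  assumes n_eq: "n = Suc k" and H_eq: "H = 2 ^ k"
begin

lemma two_H: "2 ^ n = 2 * H"
  by (simp add: n_eq H_eq)

lemma H_pos: "1 \<le> H"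
  by (simp add: H_eq)

lemma upper_rows:
  assumes "1 \<le> q" "q < H"
  shows "f (H + q) H = 2 ^ n"
  unfolding H_eq by (rule top_near_top) (use assms n_eq H_eq in auto)

text \<open>The entry after \<open>H + q\<close> lies in row \<open>H + q\<close> at column
  \<open>H + 1\<close>; that row repeats with \<open>H\<close>, so it is the entry of column
  \<open>1\<close>.\<close>

lemma H_row:
  assumes "1 \<le> q" "q \<le> H"
  shows "f H q = H + q"
  using assms
proof (induction q rule: dec_induct)
  case base
  show ?case using first_column[of H] two_H H_pos by simp
next
  case (step q)
  then have "f H (q + 1) = f (H + q) (H + 1)"
    using row_step[of H q] two_H by simp
  also have "\<dots> = f (H + q) 1"
    by (rule row_restarts) (use step upper_rows[of q] two_H in auto)
  also have "\<dots> = H + q + 1" using first_column[of "H + q"] step two_H by simp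
  finally show ?case by simp
qed

text \<open>Rows \<open>u\<close> and \<open>H + u\<close> agree modulo \<open>H\<close>, the latter
  with all values in the upper half. Both recursions pass to rows congruent modulo \<open>H\<close>,
  at columns \<open>u + 1\<close> and \<open>H + (u + 1)\<close>; the shift by \<open>H\<close> is
  harmless in rows strictly between \<open>H\<close> and \<open>2 ^ n\<close>, since they repeat
  with \<open>H\<close>.\<close>

lemma upper_row_eq:
  assumes "1 \<le> u" "u < H" "1 \<le> v" "v \<le> 2 ^ n"
  shows "f (H + u) v = (if f u v \<le> H then H + f u v else f u v)"
  using assms
proof (induction "H - u" arbitrary: u v rule: less_induct)
  case less
  note IH = less.hyps and u = less.prems(1,2)
  from less.prems(3,4) show ?case
  proof (induction v rule: dec_induct)
    case base
    show ?case using first_column[of u] first_column[of "H + u"] u two_H by simp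
  next
    case (step v)
    define w where "w = f u v"
    have w: "u < w" "w \<le> 2 ^ n"
      using row_greater[of u v] closed[of u v] step u two_H by (auto simp: w_def)
    have low: "f u (Suc v) = f w (u + 1)"
      using row_step[of u v] step u two_H by (simp add: w_def)
    have high: "f (H + u) (Suc v) = f (f (H + u) v) (H + (u + 1))"
      using row_step[of "H + u" v] step u two_H by simp
    have IHv: "f (H + u) v = (if w \<le> H then H + w else w)"
      using step by (simp add: w_def)
    have restart: "f (H + q) (H + (u + 1)) = f (H + q) (u + 1)" if "1 \<le> q" "q < H" for q
      by (rule row_restarts) (use that u upper_rows[of q] two_H in auto)
    \<comment> \<open>Only \<open>w < H\<close> needs the outer induction. For \<open>w = H\<close>
      and \<open>w = 2 ^ n\<close> row \<open>H + u\<close> has reached the identity row; for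
      \<open>w = H + q\<close> both rows have the same current value.\<close>
    consider "w < H" | "w = H" | q where "w = H + q" "1 \<le> q" "q < H" | "w = 2 ^ n"
      using w two_H by (metis add.commute le_neq_implies_less less_imp_add_positive
          linorder_neqE_nat mult_2 nat_add_left_cancel_less One_nat_def Suc_leI)
    then show ?case
    proof cases
      case 1
      then show ?thesis using low high IHv restart[of w] IH[of w "u + 1"] w u two_H by simp
    next
      case 2
      then show ?thesis using low high IHv H_row[of "u + 1"] top_row[of "H + (u + 1)"] u two_H
        by (simp add: mult_2)
    next
      case 3
      then show ?thesis
        using low high IHv restart[of q] row_greater[of w "u + 1"] u two_H by simp
    next
      case 4
      then show ?thesis
        using low high IHv top_row[of "H + (u + 1)"] top_row[of "u + 1"] u two_H by simp
    qed
  qed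
qed

text \<open>Passing from row \<open>H + u\<close> to row \<open>u\<close> at most doubles the
  period: where row \<open>H + u\<close> is \<open>2 ^ n\<close>, row \<open>u\<close> is
  \<open>H\<close> or \<open>2 ^ n\<close>, and an increasing stretch meets each of these only
  once.\<close>

lemma lower_row_top:
  assumes u: "1 \<le> u" "u < H" and i: "Suc i \<le> n" and top: "f (H + u) (2 ^ i) = 2 ^ n"
  shows "f u (2 ^ Suc i) = 2 ^ n"
proof (rule ccontr)
  assume ne: "f u (2 ^ Suc i) \<noteq> 2 ^ n"
  have u': "1 \<le> u" "u < 2 ^ n" using u two_H by auto
  have le: "(2::nat) ^ Suc i \<le> 2 ^ n" using i by (rule power_increasing) simp
  have "f (H + u) (2 ^ i + 2 ^ i) = f (H + u) (2 ^ i)"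
    by (rule row_restarts) (use u top le two_H in auto)
  then have top2: "f (H + u) (2 ^ Suc i) = 2 ^ n" using top by (simp add: mult_2)
  have long: "2 ^ Suc i < laver_period n f u"
  proof (rule ccontr)
    assume "\<not> ?thesis"
    then have "laver_period n f u < 2 ^ Suc (Suc i)"
      by (metis lessI linorder_not_less one_less_numeral_iff order_le_less_trans
          power_strict_increasing semiring_norm(76))
    with top_if_period_less[OF u'] i ne show False by blast
  qed
  with u' have "f u (2 ^ i) < f u (2 ^ Suc i)" by (intro period_increasing) auto
  moreover have "f u (2 ^ i) = H \<or> f u (2 ^ i) = 2 ^ n"
    using upper_row_eq[of u "2 ^ i"] top u le two_H by (auto split: if_splits)
  moreover have "f u (2 ^ Suc i) = H \<or> f u (2 ^ Suc i) = 2 ^ n"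
    using upper_row_eq[of u "2 ^ Suc i"] top2 u le two_H by (auto split: if_splits)
  ultimately show False using ne two_H by auto
qed

lemma row_below_H:
  assumes j: "j < k" and "1 \<le> q" "q \<le> 2 ^ j"
  shows "f (H - 2 ^ j) q = H - 2 ^ j + q"
proof -
  define p where "p = H - 2 ^ j"
  have jH: "(2::nat) ^ j < H" using j by (simp add: H_eq)
  then have p: "1 \<le> p" "p < H" "p + 2 ^ j = H" by (auto simp: p_def)
  have "(2::nat) ^ j dvd H" using j by (simp add: H_eq le_imp_power_dvd)
  then have "2 ^ j dvd p" unfolding p_def by (simp add: dvd_diff_nat)
  then obtain c where c: "p = c * 2 ^ j" by (metis dvd_def mult.commute)
  from assms(2,3) have "f p q = p + q"
  proof (induction q rule: dec_induct)
    case base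
    show ?case using first_column[of p] p two_H by simp
  next
    case (step q)
    define x where "x = p + q"
    have x: "1 \<le> x" "x < H" "H < x + 2 ^ j" using step p by (auto simp: x_def)
    \<comment> \<open>For \<open>j = 0\<close> only \<open>q = 1\<close> is in range, so there is no
      inductive step.\<close>
    have "j \<noteq> 0" using step by (cases j) auto
    then obtain i where i: "j = Suc i" by (cases j) auto
    have "f (H + x) (2 ^ i) = 2 ^ n"
      by (rule top_near_top) (use x i j n_eq two_H in auto)
    then have top: "f x (2 ^ j) = 2 ^ n" using lower_row_top[of x i] x i j n_eq by simp
    have "f p (q + 1) = f x (p + 1)"
      using row_step[of p q] step p jH two_H by (simp add: x_def)
    \<comment> \<open>As \<open>p\<close> is a multiple of \<open>2 ^ j\<close>, with which row
      \<open>x\<close> repeats, column \<open>p + 1\<close> reads as column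
      \<open>1\<close>.\<close>
    also have "\<dots> = f x (1 + c * 2 ^ j)" using c by simp
    also have "\<dots> = f x 1"
      by (rule row_periodic) (use x top c p two_H in auto)
    also have "\<dots> = x + 1" using first_column[of x] x two_H by simp
    finally show ?case by (simp add: x_def)
  qed
  then show ?thesis by (simp add: p_def)
qed

section \<open>The elements forcing \<open>H\<close>, and the cocycle identity\<close>

lemma forces_H_if:
  assumes "1 \<le> r" "r < 2 ^ n"
  shows "laver_forces n f r H"
proof -
  obtain j c where r: "r = 2 ^ j + c * 2 ^ Suc j"
    using two_power_odd_decomp assms(1) by blast
  then have "(2::nat) ^ j < 2 ^ n" using assms(2) by linarith
  then have "j < n" by (rule power_less_imp_less_exp[rotated]) simp
  show ?thesis
  proof (cases "j = k")
    \<comment> \<open>Here \<open>r < 2 ^ n\<close> leaves only \<open>r = H\<close>, which the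
      identity row fixes.\<close>
    case True
    then have "2 ^ Suc j = (2::nat) ^ n" using n_eq by simp
    with r assms(2) have "c = 0" by (cases c) auto
    with r True have "r = H" by (simp add: H_eq)
    then show ?thesis using top_row[of H] two_H H_pos
      by (auto simp: laver_forces_def laver_carrier_def intro!: bexI[of _ "2 ^ n"])
  next
    case False
    with \<open>j < n\<close> have j: "j < k" using n_eq by simp
    define p where "p = H - 2 ^ j"
    have "(2::nat) ^ j < H" using j by (simp add: H_eq)
    then have p: "1 \<le> p" "p < H" "p + 2 ^ j = H" by (auto simp: p_def)
    \<comment> \<open>Since \<open>H + p = 2 ^ n - 2 ^ j\<close>, the period of this row is at most
      \<open>2 ^ j\<close>; doubling gives \<open>2 ^ Suc j\<close> for row
      \<open>p\<close>.\<close>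
    have "f (H + p) (2 ^ j) = 2 ^ n"
      by (rule top_near_top) (use p j n_eq two_H in auto)
    then have top: "f p (2 ^ Suc j) = 2 ^ n" using lower_row_top[of p j] p j n_eq by simp
    have "f p r = f p (2 ^ j)"
      unfolding r by (rule row_periodic) (use p top r assms two_H in auto)
    also have "\<dots> = H" using row_below_H[OF j, of "2 ^ j"] p by (simp add: p_def)
    finally show ?thesis using p two_H by (auto simp: laver_forces_def laver_carrier_def)
  qed
qed

text \<open>The exception is \<open>2 ^ n\<close>, whose column is constantly \<open>2 ^ n\<close>
  and so misses \<open>H\<close>.\<close>

lemma forces_H_iff:
  assumes "r \<in> laver_carrier n"
  shows "laver_forces n f r H \<longleftrightarrow> r \<noteq> 2 ^ n"
proof
  assume "laver_forces n f r H"
  then show "r \<noteq> 2 ^ n" using last_column two_H H_pos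
    by (auto simp: laver_forces_def laver_carrier_def)
next
  assume "r \<noteq> 2 ^ n"
  with assms show "laver_forces n f r H" by (auto simp: laver_carrier_def intro: forces_H_if)
qed

text \<open>Summing the Kronecker symbols over all \<open>r\<close> except \<open>2 ^ n\<close>
  gives indicators of being different from \<open>2 ^ n\<close>; the constants \<open>1\<close>
  cancel in the difference.\<close>

lemma psi_H_eq:
  assumes "x \<in> laver_carrier n" "y \<in> laver_carrier n"
  shows "laver_psi n f H x y = - laver_phi f (2 ^ n) x y"
proof -
  let ?R = "laver_carrier n - {2 ^ n}"
  have fin: "finite ?R" by (simp add: laver_carrier_def)
  have xy: "f x y \<in> laver_carrier n" using assms closed by (auto simp: laver_carrier_def)
  have "{r. r \<in> laver_carrier n \<and> laver_forces n f r H} = ?R"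
    using forces_H_iff by auto
  then have "laver_psi n f H x y = (\<Sum>r\<in>?R. of_bool (y = r)) - (\<Sum>r\<in>?R. of_bool (f x y = r))"
    by (simp add: laver_psi_def laver_phi_def sum_subtractf)
  also have "\<dots> = of_bool (y \<in> ?R) - of_bool (f x y \<in> ?R)"
    using fin by (simp add: of_bool_def sum.delta)
  finally show ?thesis using assms xy by (simp add: laver_phi_def)
qed

end

section \<open>Reading the periods off the cocycle\<close>

theorem proposition5p2:
  fixes n :: nat and f :: "nat \<Rightarrow> nat \<Rightarrow> nat"
  assumes "n \<ge> 1" and "laver_table n f"
  shows "(\<forall>x\<in>laver_carrier n. \<forall>y\<in>laver_carrier n.
            laver_psi n f (2 ^ (n - 1)) x y = - laver_phi f (2 ^ n) x y) \<and>
         (\<forall>p. 1 \<le> p \<and> p < 2 ^ n \<longrightarrow>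
            laver_period n f p \<in> laver_carrier n \<and>
            laver_psi n f (2 ^ (n - 1)) p (laver_period n f p) = 1 \<and>
            (\<forall>y\<in>laver_carrier n. laver_psi n f (2 ^ (n - 1)) p y = 1 \<longrightarrow> laver_period n f p \<le> y))"
proof -
  define H :: nat where "H = 2 ^ (n - 1)"
  interpret laver_half n f H "n - 1" using assms by unfold_locales (auto simp: H_def)
  have psi: "laver_psi n f H p y = of_bool (f p y = 2 ^ n) - of_bool (y = 2 ^ n)"
    if "1 \<le> p" "p < 2 ^ n" "y \<in> laver_carrier n" for p y
    using psi_H_eq[of p y] that by (simp add: laver_phi_def laver_carrier_def)
  have "laver_period n f p \<in> laver_carrier n \<and> laver_psi n f H p (laver_period n f p) = 1 \<and>
      (\<forall>y\<in>laver_carrier n. laver_psi n f H p y = 1 \<longrightarrow> laver_period n f p \<le> y)"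
    if p: "1 \<le> p" "p < 2 ^ n" for p
  proof (intro conjI ballI impI)
    have *: "laver_period n f p \<in> laver_carrier n" "f p (laver_period n f p) = 2 ^ n"
      using period[OF p] by (auto simp: is_laver_period_def)
    show "laver_period n f p \<in> laver_carrier n" by fact
    show "laver_psi n f H p (laver_period n f p) = 1"
      \<comment> \<open>The period is at most \<open>2 ^ n - p < 2 ^ n\<close>, so the subtracted
        indicator vanishes.\<close>
      using psi[OF p *(1)] *(2) add_period_le[OF p] p by auto
    fix y assume "y \<in> laver_carrier n" "laver_psi n f H p y = 1"
    then show "laver_period n f p \<le> y"
      using psi[OF p, of y] period_least[OF p, of y]
      by (auto simp: laver_carrier_def of_bool_def split: if_splits)
  qed
  with psi_H_eq show ?thesis unfolding H_def by blast
qed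

end
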